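(* For a pattern $p$, let $F_p(x,y)=\sum_{n\geq 0}\sum_{k\geq 0}a_{n,k}x^ny^k$, where $a_{n,k}$ is the number of paths in $\mathcal{D}_n^{h,\geq}$ containing exactly $k$ occurrences of $p$. Let $A=(x+1)(x^2y-x^2+xy-x-1)(x^3y-x^3-2x^2y+2x^2+xy+2x-1)$, $B=(x+1)(x^2y-x^2+1)(x^3y-x^3-3x^2y+3x^2-3x+1)$, $C=(x+1)(x^2y-x^2+1)(x^3y-x^3-3x^2y+3x^2-3x+1)$, $D=(xy+1)(x^2y-x^2-xy+x-1)(x^3y^2-x^3y-x^2y^2-2x^2y+3x^2+2xy+x-1)$. Then $$F_{UDU}(x,y)=\frac{1+x(x^2-x^2y-y)-\sqrt{A}}{2x^2(x-xy+1)},$$ $$F_{UDD}(x,y)=\frac{1+x(x^2y-x^2-xy+x-1)-\sqrt{B}}{2x^2(xy-x+1)^2},$$ $$F_{DDU}(x,y)=\frac{1+x(2x^2y^2-3x^2y+x^2+xy-x-1)-\sqrt{C}}{2x^2y(xy-x+1)},$$ $$F_{DDD}(x,y)=\frac{1-x(x^2y^2-x^2y-xy^2+x+1)-\sqrt{D}}{2x^2(xy-x-y)^2}.$$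
   Context: Dyck paths are lattice paths with steps $U=(1,1)$, $D=(1,-1)$ from $(0,0)$ to $(2n,0)$ never going below the $x$-axis ($n$ is the semilength). Every nonempty Dyck path $P$ has a unique first return decomposition $P=U\alpha D\beta$ with $\alpha,\beta$ Dyck paths. Let $h(P)$ denote the maximal height of a Dyck path. The set $\mathcal{D}^{h,\geq}$ is defined recursively: it contains the empty path, and a nonempty Dyck path $P=U\alpha D\beta$ belongs to $\mathcal{D}^{h,\geq}$ iff $\alpha,\beta\in\mathcal{D}^{h,\geq}$ and $h(U\alpha D)\geq h(\beta)$. $\mathcal{D}_n^{h,\geq}$ is the set of its elements of semilength $n$. An occurrence of a pattern in a path is an occurrence as a sequence of consecutive steps. *)

theory Defs
  imports "HOL-Computational_Algebra.Computational_Algebra"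
begin

datatype step = Up | Down

definition level :: "step list \<Rightarrow> int" where
  "level P = int (count_list P Up) - int (count_list P Down)"

definition dyck_path :: "step list \<Rightarrow> bool" where
  "dyck_path P \<longleftrightarrow> (\<forall>i\<le>length P. level (take i P) \<ge> 0) \<and> level P = 0"

definition height :: "step list \<Rightarrow> int" where
  "height P = Max ((\<lambda>i. level (take i P)) ` {..length P})"

text \<open>
  The class of Dyck paths built by the first return decomposition. The lemma
  \<open>dyck_h_geq_decomp\<close> below gives the recursive characterisation as an equivalence.
\<close>

inductive_set dyck_h_geq :: "step list set" where
  Nil: "[] \<in> dyck_h_geq"
| decomp: "\<alpha> \<in> dyck_h_geq \<Longrightarrow> \<beta> \<in> dyck_h_geq \<Longrightarrow> height (Up # \<alpha> @ [Down]) \<ge> height \<beta> \<Longrightarrow>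
    Up # \<alpha> @ Down # \<beta> \<in> dyck_h_geq"

lemma level_simps [simp]:
  "level [] = 0" "level (Up # P) = level P + 1" "level (Down # P) = level P - 1"
  "level (P @ Q) = level P + level Q"
  by (auto simp: level_def)

lemma dyck_path_Nil: "dyck_path []"
  by (simp add: dyck_path_def)

lemma dyck_path_decomp:
  assumes "dyck_path \<alpha>" "dyck_path \<beta>"
  shows "dyck_path (Up # \<alpha> @ Down # \<beta>)"
proof -
  have "level (take i (Up # \<alpha> @ Down # \<beta>)) \<ge> 0" if "i \<le> length (Up # \<alpha> @ Down # \<beta>)" for i
  proof (cases "i \<le> Suc (length \<alpha>)")
    case True
    then show ?thesis
      using assms(1) by (cases i) (auto simp: dyck_path_def)
  next
    case False
    define j where "j = i - Suc (Suc (length \<alpha>))"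
    with False have j: "i = Suc (Suc (length \<alpha> + j))" by simp
    with that have "j \<le> length \<beta>" by simp
    then show ?thesis
      using assms j by (auto simp: dyck_path_def)
  qed
  then show ?thesis
    using assms by (auto simp: dyck_path_def)
qed

lemma dyck_h_geq_imp_dyck_path: "P \<in> dyck_h_geq \<Longrightarrow> dyck_path P"
  by (induction rule: dyck_h_geq.induct) (auto intro: dyck_path_Nil dyck_path_decomp)

lemma first_return_unique:
  assumes "dyck_path \<alpha>" "dyck_path \<alpha>'" "\<alpha> @ Down # \<beta> = \<alpha>' @ Down # \<beta>'"
  shows "\<alpha> = \<alpha>' \<and> \<beta> = \<beta>'"
proof -
  have *: "\<not> length a < length b"
    if "dyck_path a" "dyck_path b" "a @ Down # c = b @ Down # d" for a b c d :: "step list"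
  proof
    assume less: "length a < length b"
    have "take (Suc (length a)) b = take (Suc (length a)) (b @ Down # d)"
      using less by simp
    also have "\<dots> = a @ [Down]"
      unfolding that(3)[symmetric] by simp
    finally have "level (take (Suc (length a)) b) = -1"
      using that(1) by (simp add: dyck_path_def)
    then show False
      using that(2) less unfolding dyck_path_def
      by (metis Suc_leI neg_0_le_iff_le not_one_le_zero)
  qed
  have "length \<alpha> = length \<alpha>'"
    using *[OF assms] *[OF assms(2,1) assms(3)[symmetric]] by simp
  then show ?thesis
    using assms(3) by simp
qed

lemma dyck_h_geq_decomp:
  assumes "dyck_path \<alpha>" "dyck_path \<beta>"
  shows "Up # \<alpha> @ Down # \<beta> \<in> dyck_h_geq \<longleftrightarrow>
    \<alpha> \<in> dyck_h_geq \<and> \<beta> \<in> dyck_h_geq \<and> height (Up # \<alpha> @ [Down]) \<ge> height \<beta>"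
    (is "?L \<longleftrightarrow> ?R")
proof
  assume ?L
  then show ?R
  proof cases
    case (decomp \<alpha>' \<beta>')
    then have "\<alpha> @ Down # \<beta> = \<alpha>' @ Down # \<beta>'" by simp
    then have "\<alpha> = \<alpha>' \<and> \<beta> = \<beta>'"
      using first_return_unique assms(1) dyck_h_geq_imp_dyck_path[OF decomp(2)] by blast
    then show ?thesis
      using decomp by simp
  qed
qed (auto intro: dyck_h_geq.decomp)

text \<open>Occurrences may overlap.\<close>

definition occurrences :: "step list \<Rightarrow> step list \<Rightarrow> nat" where
  "occurrences p P = card {i. i + length p \<le> length P \<and> take (length p) (drop i P) = p}"

definition num_paths :: "step list \<Rightarrow> nat \<Rightarrow> nat \<Rightarrow> nat" where
  "num_paths p n k = card {P \<in> dyck_h_geq. length P = 2 * n \<and> occurrences p P = k}"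

text \<open>
  Bivariate series are series in \<open>x\<close> whose coefficients are series in \<open>y\<close>; thus
  \<open>x\<close> is \<^term>\<open>fps_X :: real fps fps\<close> and \<open>y\<close> is \<^term>\<open>fps_const fps_X :: real fps fps\<close>.
  Quotients of such series by non-units are taken in the fraction field, via \<^const>\<open>to_fract\<close>.
\<close>

definition pattern_gf :: "step list \<Rightarrow> real fps fps" where
  "pattern_gf p = Abs_fps (\<lambda>n. Abs_fps (\<lambda>k. of_nat (num_paths p n k)))"

text \<open>
  The square root of a series with constant term \<open>1\<close>: of the two roots, the one whose
  constant term is \<open>1\<close> (and not \<open>-1\<close>).
\<close>

definition gf_sqrt :: "real fps fps \<Rightarrow> real fps fps" where
  "gf_sqrt A = (THE S. S\<^sup>2 = A \<and> fps_nth (fps_nth S 0) 0 = 1)"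

lemma gf_sqrt_eqI:
  assumes "S\<^sup>2 = A" "fps_nth (fps_nth S 0) 0 = 1"
  shows "gf_sqrt A = S"
  unfolding gf_sqrt_def
proof (rule the_equality)
  fix T :: "real fps fps"
  assume T: "T\<^sup>2 = A \<and> fps_nth (fps_nth T 0) 0 = 1"
  with assms(1) have "T\<^sup>2 = S\<^sup>2" by simp
  then have "T = S \<or> T = - S"
    by (rule power2_eq_iff[THEN iffD1])
  then show "T = S"
    using T assms(2) by auto
qed (use assms in auto)

end

theory Submission
  imports Defs
begin

text \<open>
  For each pattern there is a weight \<open>v P = y ^ (occurrences + correction at the end of P)\<close> with
  \<open>v (U \<alpha> D \<beta>) = v \<alpha> * v \<beta>\<close> whenever \<open>\<alpha>\<close> is nonempty. If \<open>a k\<close> and \<open>b k\<close> are the \<open>v\<close>-weighted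
  series of the paths of height exactly, respectively at most, \<open>k + 1\<close>, then
  \<open>a (k+1) = x * a k * b (k+1)\<close> and \<open>b (k+1) = b k + a (k+1)\<close>. This is a QRT map: eliminating \<open>b\<close> gives
  \<open>a (k+1) * a (k-1) = (a k)\<^sup>2 / (1 - x * a k)\<close>, and \<open>x a + a / b - 1 / (x b) - x b\<close> is constant along
  the orbit. Since \<open>a k\<close> tends to \<open>0\<close> and \<open>b k\<close> to the full series \<open>V\<close>, comparing the invariant at
  \<open>k = 0\<close> with its limit is a quadratic equation for \<open>V\<close>. The patterns enter only through the
  paths of height at most 1 and through the removal of the correction from \<open>V\<close>.
\<close>

section \<open>Heights and the first return decomposition\<close>

lemma height_Nil [simp]: "height [] = 0"
  by (simp add: height_def)

lemma height_Cons: "height (s # P) = max 0 (level [s] + height P)"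
proof -
  have "(\<lambda>i. level (take i (s # P))) ` {..length (s # P)} =
      insert 0 ((\<lambda>i. level [s] + level (take i P)) ` {..length P})"
    by (cases s) (auto simp: atMost_Suc_eq_insert_0 image_image)
  moreover have "Max ((\<lambda>i. level [s] + level (take i P)) ` {..length P}) = level [s] + height P"
    unfolding height_def
    using Max_add_commute[of "{..length P}" "\<lambda>i. level (take i P)" "level [s]"]
    by (simp add: add.commute)
  ultimately show ?thesis
    unfolding height_def[of "s # P"] by simp
qed

lemma height_nonneg: "height P \<ge> 0"
  by (cases P) (auto simp: height_Cons)

lemma height_append: "height (P @ Q) = max (height P) (level P + height Q)"
proof (induction P)
  case (Cons s P)
  then show ?case by (cases s) (auto simp: height_Cons)
qed (simp add: height_nonneg)

lemma height_decomp:
  assumes "dyck_path \<alpha>"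
  shows "height (Up # \<alpha> @ [Down]) = height \<alpha> + 1"
    and "height (Up # \<alpha> @ Down # \<beta>) = max (height \<alpha> + 1) (height \<beta>)"
  using assms height_nonneg[of \<alpha>]
  by (auto simp: height_append height_Cons dyck_path_def)

text \<open>The height condition makes \<open>Up # \<alpha> @ [Down]\<close> reach the maximum, so
  the height of a nonempty path depends on \<alpha> alone. This is what lets the height classes
  factor.\<close>

lemma dyck_h_geq_cases [consumes 1, case_names Nil decomp]:
  assumes "P \<in> dyck_h_geq"
  obtains "P = []"
  | \<alpha> \<beta> where "\<alpha> \<in> dyck_h_geq" "\<beta> \<in> dyck_h_geq" "height \<beta> \<le> height \<alpha> + 1"
      "P = Up # \<alpha> @ Down # \<beta>" "height P = height \<alpha> + 1"
  using assms
proof cases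
  case (decomp \<alpha> \<beta>)
  then show ?thesis
    using that(2)[of \<alpha> \<beta>] height_decomp(1)[of \<alpha>] height_decomp(2)[of \<alpha> \<beta>] dyck_h_geq_imp_dyck_path[of \<alpha>] by auto
qed (use that in blast)

lemma dyck_h_geq_even_length: "P \<in> dyck_h_geq \<Longrightarrow> even (length P)"
  by (induction rule: dyck_h_geq.induct) auto

text \<open>Each coefficient of a generating function therefore sees only finitely many heights; the
  limits in the height bound rest on this.\<close>

lemma dyck_h_geq_height_le_length: "P \<in> dyck_h_geq \<Longrightarrow> 2 * height P \<le> length P"
proof (induction rule: dyck_h_geq.induct)
  case (decomp \<alpha> \<beta>)
  then show ?case
    using height_decomp(1)[of \<alpha>] height_decomp(2)[of \<alpha> \<beta>] dyck_h_geq_imp_dyck_path[of \<alpha>] by auto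
qed simp

lemma dyck_h_geq_hd_last:
  assumes "P \<in> dyck_h_geq" "P \<noteq> []"
  shows "hd P = Up" "last P = Down"
proof -
  have "P \<noteq> [] \<longrightarrow> hd P = Up \<and> last P = Down"
    using assms(1) by (induction rule: dyck_h_geq.induct) auto
  then show "hd P = Up" "last P = Down"
    using assms(2) by auto
qed

section \<open>The class split by height\<close>

definition height_eq :: "nat \<Rightarrow> step list set" where
  "height_eq k = {P \<in> dyck_h_geq. height P = int k}"

definition height_le :: "nat \<Rightarrow> step list set" where
  "height_le k = {P \<in> dyck_h_geq. height P \<le> int k}"

text \<open>Written on pairs, so that the decomposition is an injective image of a product and sums
  can be reindexed along it.\<close>

definition first_return :: "step list \<times> step list \<Rightarrow> step list" where
  "first_return = (\<lambda>(\<alpha>, \<beta>). Up # \<alpha> @ Down # \<beta>)"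

lemma inj_on_first_return: "inj_on first_return (dyck_h_geq \<times> dyck_h_geq)"
proof (rule inj_onI, clarify)
  fix \<alpha> \<beta> \<alpha>' \<beta>'
  assume "\<alpha> \<in> dyck_h_geq" "\<alpha>' \<in> dyck_h_geq" "first_return (\<alpha>, \<beta>) = first_return (\<alpha>', \<beta>')"
  then show "\<alpha> = \<alpha>' \<and> \<beta> = \<beta>'"
    by (intro first_return_unique dyck_h_geq_imp_dyck_path) (auto simp: first_return_def)
qed

lemma height_eq_Suc: "height_eq (Suc k) = first_return ` (height_eq k \<times> height_le (Suc k))"
  (is "?L = ?R")
proof
  show "?L \<subseteq> ?R"
  proof
    fix P assume "P \<in> ?L"
    then have "P \<in> dyck_h_geq" "height P = int k + 1"
      by (auto simp: height_eq_def)
    then show "P \<in> ?R"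
    proof (cases rule: dyck_h_geq_cases)
      case (decomp \<alpha> \<beta>)
      with \<open>height P = int k + 1\<close> have "(\<alpha>, \<beta>) \<in> height_eq k \<times> height_le (Suc k)"
        by (auto simp: height_eq_def height_le_def)
      then show ?thesis
        using decomp by (force simp: first_return_def)
    qed simp
  qed
  show "?R \<subseteq> ?L"
    by (auto simp: height_eq_def height_le_def first_return_def height_decomp
        dyck_h_geq_imp_dyck_path intro!: dyck_h_geq.decomp)
qed

lemma height_le_Suc:
  "height_le (Suc k) = height_le k \<union> height_eq (Suc k)" "height_le k \<inter> height_eq (Suc k) = {}"
  by (auto simp: height_le_def height_eq_def)

lemma height_eq_0: "height_eq 0 = {[]}"
proof -
  have "P = []" if "P \<in> height_eq 0" for P
  proof -
    have "P \<in> dyck_h_geq" "height P = 0"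
      using that by (auto simp: height_eq_def)
    then show ?thesis
    proof (cases rule: dyck_h_geq_cases)
      case (decomp \<alpha> \<beta>)
      then show ?thesis
        using height_nonneg[of \<alpha>] \<open>height P = 0\<close> by simp
    qed
  qed
  then show ?thesis
    by (auto simp: height_eq_def dyck_h_geq.Nil)
qed

lemma height_le_0: "height_le 0 = {[]}"
proof -
  have "height_le 0 = height_eq 0"
    using height_nonneg by (auto simp: height_le_def height_eq_def intro: order_antisym)
  then show ?thesis by (simp add: height_eq_0)
qed

section \<open>Weighted generating functions by semilength\<close>

definition gf :: "(step list \<Rightarrow> 'a::comm_ring_1) \<Rightarrow> step list set \<Rightarrow> 'a fps" where
  "gf v S = Abs_fps (\<lambda>n. \<Sum>P | P \<in> S \<and> length P = 2 * n. v P)"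

lemma finite_length_eq: "finite {P :: step list. P \<in> S \<and> length P = n}"
proof -
  have "(UNIV :: step set) = {Up, Down}"
    using step.exhaust by auto
  then have "finite (UNIV :: step set)"
    by (metis finite.emptyI finite_insert)
  from finite_lists_length_eq[OF this, of n] show ?thesis
    by (rule rev_finite_subset) auto
qed

lemma gf_union: "S \<inter> T = {} \<Longrightarrow> gf v (S \<union> T) = gf v S + gf v T"
proof (rule fps_ext)
  fix n assume "S \<inter> T = {}"
  moreover have "{P. P \<in> S \<union> T \<and> length P = 2 * n} =
      {P. P \<in> S \<and> length P = 2 * n} \<union> {P. P \<in> T \<and> length P = 2 * n}" by blast
  ultimately show "gf v (S \<union> T) $ n = (gf v S + gf v T) $ n"
    by (simp add: gf_def, subst sum.union_disjoint) (auto simp: finite_length_eq)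
qed

lemma gf_scale: "(\<And>P. P \<in> S \<Longrightarrow> v P = c * w P) \<Longrightarrow> gf v S = fps_const c * gf w S"
  by (rule fps_ext) (auto simp: gf_def sum_distrib_left intro!: sum.cong)

lemma gf_Nil: "gf v {[]} = fps_const (v [])"
proof (rule fps_ext)
  fix n
  have "{P. P \<in> {[]::step list} \<and> length P = 2 * n} = (if n = 0 then {[]} else {})"
    by auto
  then show "gf v {[]} $ n = fps_const (v []) $ n"
    by (simp add: gf_def)
qed

text \<open>Three weights are allowed because the path and its two components may carry different
  end corrections. The factor x accounts for the added pair of steps.\<close>

lemma gf_first_return:
  assumes "S \<subseteq> dyck_h_geq" "T \<subseteq> dyck_h_geq"
    and "\<And>\<alpha> \<beta>. \<alpha> \<in> S \<Longrightarrow> \<beta> \<in> T \<Longrightarrow> u (Up # \<alpha> @ Down # \<beta>) = v \<alpha> * w \<beta>"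
  shows "gf u (first_return ` (S \<times> T)) = fps_X * (gf v S * gf w T)"
proof (rule fps_ext)
  fix n
  show "gf u (first_return ` (S \<times> T)) $ n = (fps_X * (gf v S * gf w T)) $ n"
  proof (cases n)
    case 0
    \<comment> \<open>A decomposed path has length at least 2, matching the zero constant term of
      the product with x.\<close>
    have "{P. P \<in> first_return ` (S \<times> T) \<and> length P = 2 * 0} = {}"
      by (auto simp: first_return_def)
    then show ?thesis
      by (simp only: gf_def 0 fps_nth_Abs_fps sum.empty fps_X_mult_nth simp_thms if_True)
  next
    case (Suc m)
    let ?S = "\<lambda>i. {P. P \<in> S \<and> length P = 2 * i}" and ?T = "\<lambda>i. {P. P \<in> T \<and> length P = 2 * i}"
    let ?I = "\<Union>i\<in>{..m}. ?S i \<times> ?T (m - i)"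
    have set_eq: "{P. P \<in> first_return ` (S \<times> T) \<and> length P = 2 * n} = first_return ` ?I"
    proof
      show "first_return ` ?I \<subseteq> {P. P \<in> first_return ` (S \<times> T) \<and> length P = 2 * n}"
      proof
        fix P assume "P \<in> first_return ` ?I"
        then obtain i \<alpha> \<beta> where P: "P = first_return (\<alpha>, \<beta>)" "\<alpha> \<in> S" "\<beta> \<in> T" "i \<le> m"
          "length \<alpha> = 2 * i" "length \<beta> = 2 * (m - i)"
          by blast
        then have "length P = 2 * n"
          by (simp add: first_return_def Suc)
        with P show "P \<in> {P. P \<in> first_return ` (S \<times> T) \<and> length P = 2 * n}"
          by blast
      qed
      show "{P. P \<in> first_return ` (S \<times> T) \<and> length P = 2 * n} \<subseteq> first_return ` ?I"
      proof
        fix P assume "P \<in> {P. P \<in> first_return ` (S \<times> T) \<and> length P = 2 * n}"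
        then obtain \<alpha> \<beta> where P: "P = first_return (\<alpha>, \<beta>)" "\<alpha> \<in> S" "\<beta> \<in> T"
          "length \<alpha> + length \<beta> = 2 * m"
          unfolding Suc by (force simp: first_return_def)
        \<comment> \<open>Parity is needed to halve the lengths: with total length 2m it yields the
          semilengths i and m - i.\<close>
        have "even (length \<alpha>)" "even (length \<beta>)"
          using P assms(1,2) dyck_h_geq_even_length by blast+
        then obtain i j where ij: "length \<alpha> = 2 * i" "length \<beta> = 2 * j"
          by (elim evenE)
        then have "i \<in> {..m}" "m - i = j"
          using P(4) by auto
        then have "(\<alpha>, \<beta>) \<in> ?I"
          using P(2,3) ij by blast
        with P show "P \<in> first_return ` ?I" by blast
      qed
    qed
    have sub: "?I \<subseteq> dyck_h_geq \<times> dyck_h_geq"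
      using assms(1,2) by blast
    have "gf u (first_return ` (S \<times> T)) $ n = sum u (first_return ` ?I)"
      unfolding gf_def fps_nth_Abs_fps set_eq ..
    also have "\<dots> = (\<Sum>(\<alpha>, \<beta>)\<in>?I. v \<alpha> * w \<beta>)"
      unfolding sum.reindex[OF inj_on_subset[OF inj_on_first_return sub]]
    proof (rule sum.cong[OF refl])
      fix z assume "z \<in> ?I"
      then obtain \<alpha> \<beta> where "z = (\<alpha>, \<beta>)" "\<alpha> \<in> S" "\<beta> \<in> T" by blast
      then show "(u \<circ> first_return) z = (case z of (\<alpha>, \<beta>) \<Rightarrow> v \<alpha> * w \<beta>)"
        by (simp add: first_return_def assms(3))
    qed
    also have "\<dots> = (\<Sum>i\<le>m. \<Sum>(\<alpha>, \<beta>)\<in>?S i \<times> ?T (m - i). v \<alpha> * w \<beta>)"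
    proof (rule sum.UNION_disjoint)
      show "\<forall>i\<in>{..m}. finite (?S i \<times> ?T (m - i))"
        by (intro ballI finite_cartesian_product finite_length_eq)
      show "\<forall>i\<in>{..m}. \<forall>j\<in>{..m}. i \<noteq> j \<longrightarrow> ?S i \<times> ?T (m - i) \<inter> ?S j \<times> ?T (m - j) = {}"
        by force
    qed simp
    also have "\<dots> = (gf v S * gf w T) $ m"
      unfolding fps_mult_nth gf_def fps_nth_Abs_fps sum_product sum.cartesian_product atLeast0AtMost ..
    finally show ?thesis
      using Suc by simp
  qed
qed

text \<open>Height at least 2 forces \<alpha> to be nonempty, as the product rule requires; height 1
  is treated separately.\<close>

lemma gf_height_eq_Suc:
  assumes "\<And>\<alpha> \<beta>. \<alpha> \<in> dyck_h_geq \<Longrightarrow> \<beta> \<in> dyck_h_geq \<Longrightarrow> \<alpha> \<noteq> [] \<Longrightarrow>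
      w (Up # \<alpha> @ Down # \<beta>) = v \<alpha> * w \<beta>"
  shows "gf w (height_eq (Suc (Suc k))) =
      fps_X * gf v (height_eq (Suc k)) * gf w (height_le (Suc (Suc k)))"
  unfolding height_eq_Suc[of "Suc k"] mult.assoc
proof (rule gf_first_return)
  fix \<alpha> \<beta> assume "\<alpha> \<in> height_eq (Suc k)" "\<beta> \<in> height_le (Suc (Suc k))"
  then have "\<alpha> \<in> dyck_h_geq" "\<beta> \<in> dyck_h_geq" "\<alpha> \<noteq> []"
    unfolding height_eq_def height_le_def by auto
  then show "w (Up # \<alpha> @ Down # \<beta>) = v \<alpha> * w \<beta>"
    by (rule assms)
qed (auto simp: height_eq_def height_le_def)

lemma gf_height_le_Suc: "gf v (height_le (Suc k)) = gf v (height_le k) + gf v (height_eq (Suc k))"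
  unfolding height_le_Suc(1) by (rule gf_union) (rule height_le_Suc(2))

text \<open>Paths of height at most 1 are powers of UD, so these are geometric series with
  denominator \<open>t\<close>, kept multiplied out. The weights of the empty path and of UD are
  \<open>e\<close> and \<open>d\<close>; each further UD contributes \<open>c\<close>.\<close>

lemma gf_height_1:
  assumes "\<And>\<beta>. \<beta> \<in> dyck_h_geq \<Longrightarrow> \<beta> \<noteq> [] \<Longrightarrow> v (Up # Down # \<beta>) = c * v \<beta>"
    and "v [Up, Down] = d" and "v [] = e"
  defines "t \<equiv> 1 - fps_const c * fps_X"
  shows "t * gf v (height_eq 1) = fps_const d * fps_X"
    and "t * gf v (height_le 1) = fps_const e * t + fps_const d * fps_X"
proof -
  \<comment> \<open>This is the weight of UD followed by \<beta>; \<open>d\<close> is separate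
    because \<open>c\<close> governs only nonempty \<beta>.\<close>
  define w where "w \<beta> = (if \<beta> = [] then d else c * v \<beta>)" for \<beta>
  have "gf v (height_eq 1) = fps_X * (gf (\<lambda>_. 1) (height_eq 0) * gf w (height_le 1))"
    unfolding One_nat_def height_eq_Suc
  proof (rule gf_first_return)
    fix \<alpha> \<beta> assume "\<alpha> \<in> height_eq 0" "\<beta> \<in> height_le (Suc 0)"
    then show "v (Up # \<alpha> @ Down # \<beta>) = 1 * w \<beta>"
      using assms by (auto simp: height_eq_0 height_le_def w_def)
  qed (auto simp: height_eq_def height_le_def)
  also have "\<dots> = fps_X * gf w (height_le 1)"
    unfolding height_eq_0 gf_Nil by simp
  also have "gf w (height_le 1) = gf w (height_le 0) + gf w (height_eq 1)"
    using gf_height_le_Suc[of w 0] by simp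
  also have "gf w (height_le 0) = fps_const d"
    by (simp add: height_le_0 gf_Nil w_def)
  also have "gf w (height_eq 1) = fps_const c * gf v (height_eq 1)"
    by (rule gf_scale) (auto simp: w_def height_eq_def)
  finally have a: "gf v (height_eq 1) = fps_X * (fps_const d + fps_const c * gf v (height_eq 1))" .
  have "t * gf v (height_eq 1) = gf v (height_eq 1) - fps_X * (fps_const c * gf v (height_eq 1))"
    unfolding t_def by (simp add: algebra_simps)
  \<comment> \<open>Only the first occurrence is replaced, since the right side of \<open>a\<close>
    contains its left side.\<close>
  also have "\<dots> = fps_X * (fps_const d + fps_const c * gf v (height_eq 1)) -
      fps_X * (fps_const c * gf v (height_eq 1))"
    by (rule arg_cong[OF a])
  also have "\<dots> = fps_const d * fps_X"
    by (simp add: algebra_simps)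
  finally show *: "t * gf v (height_eq 1) = fps_const d * fps_X" .
  have "gf v (height_le 1) = fps_const e + gf v (height_eq 1)"
    using gf_height_le_Suc[of v 0] by (simp add: height_le_0 gf_Nil assms(3))
  then show "t * gf v (height_le 1) = fps_const e * t + fps_const d * fps_X"
    using * by (simp add: distrib_left mult.commute)
qed

section \<open>Limits in the height bound and the invariant\<close>

lemma fps_eq_0_if_X_power_dvd:
  fixes f :: "'a::comm_ring_1 fps"
  assumes "\<And>k. fps_X ^ k dvd f"
  shows "f = 0"
proof (rule fps_ext)
  fix n
  obtain g where "f = fps_X ^ Suc n * g"
    using assms by (meson dvdE)
  then show "f $ n = 0 $ n"
    by (simp only: fps_X_power_mult_nth) simp
qed

text \<open>The omitted paths have height above k, hence semilength above k.\<close>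

lemma X_power_dvd_gf_diff: "fps_X ^ k dvd gf v dyck_h_geq - gf v (height_le k)"
proof -
  have "dyck_h_geq = height_le k \<union> (dyck_h_geq - height_le k)"
    by (auto simp: height_le_def)
  then have "gf v dyck_h_geq = gf v (height_le k) + gf v (dyck_h_geq - height_le k)"
    using gf_union[of "height_le k" "dyck_h_geq - height_le k" v] by auto
  moreover have "gf v (dyck_h_geq - height_le k) = fps_X ^ k * fps_shift k (gf v (dyck_h_geq - height_le k))"
  proof (rule fps_ext)
    fix n
    have "{P. P \<in> dyck_h_geq - height_le k \<and> length P = 2 * n} = {}" if "n < k"
      using that dyck_h_geq_height_le_length by (force simp: height_le_def)
    then have "gf v (dyck_h_geq - height_le k) $ n = 0" if "n < k"
      by (simp only: gf_def that fps_nth_Abs_fps sum.empty)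
    then show "gf v (dyck_h_geq - height_le k) $ n =
        (fps_X ^ k * fps_shift k (gf v (dyck_h_geq - height_le k))) $ n"
      by (simp only: fps_X_power_mult_nth) simp
  qed
  ultimately show ?thesis
    by (metis add_diff_cancel_left' dvd_triv_left)
qed

lemma one_minus_X_mult_nonzero: "1 - fps_X * f \<noteq> (0 :: 'a::idom fps)" "1 - f * fps_X \<noteq> (0 :: 'a::idom fps)"
proof -
  have "(1 - fps_X * f) $ 0 \<noteq> 0" by simp
  then show "1 - fps_X * f \<noteq> 0" by (metis fps_zero_nth)
  then show "1 - f * fps_X \<noteq> 0" by (simp add: mult.commute)
qed


text \<open>The quotient of \<open>N k\<close> by \<open>b k\<close> is x times the invariant of the
  orbit. It is cross-multiplied because \<open>b k\<close> need not be a unit: for DDD its constant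
  term is y.\<close>

lemma recurrence_invariant:
  fixes a b :: "nat \<Rightarrow> 'a::idom fps"
  assumes a: "\<And>k. a (Suc k) = fps_X * a k * b (Suc k)"
    and b: "\<And>k. b (Suc k) = b k + a (Suc k)"
  defines "N \<equiv> \<lambda>k. fps_X\<^sup>2 * a k * b k + fps_X * a k - 1 - fps_X\<^sup>2 * (b k)\<^sup>2"
  shows "N 0 * b k = N k * b 0"
proof (induction k)
  case (Suc k)
  have bk: "b k = b (Suc k) * (1 - fps_X * a k)"
    using a[of k] b[of k] by (simp add: algebra_simps)
  \<comment> \<open>The factor \<open>1 - fps_X * a k\<close> splits off \<open>N k\<close> just as
    it does off \<open>b k\<close>, so their ratio is unchanged.\<close>
  have "N k = N (Suc k) * (1 - fps_X * a k)"
    unfolding N_def bk a[of k] by (simp add: algebra_simps power2_eq_square)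
  with Suc bk have "(N 0 * b (Suc k)) * (1 - fps_X * a k) = (N (Suc k) * b 0) * (1 - fps_X * a k)"
    by (simp add: mult_ac)
  then show ?case
    using one_minus_X_mult_nonzero(1)[of "a k"] by (metis mult_right_cancel)
qed simp

lemma recurrence_X_power_dvd:
  fixes a b :: "nat \<Rightarrow> 'a::comm_ring_1 fps"
  assumes "\<And>k. a (Suc k) = fps_X * a k * b (Suc k)"
  shows "fps_X ^ k dvd a k"
proof (induction k)
  case (Suc k)
  then have "fps_X * fps_X ^ k dvd fps_X * a k"
    by (rule mult_dvd_mono[OF dvd_refl])
  then show ?case
    unfolding assms[of k] by simp
qed simp

text \<open>As \<open>a k\<close> tends to 0 and \<open>b k\<close> to \<open>V\<close>, the limit
  of the numerator is -(1 + x^2 V^2).\<close>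

lemma recurrence_limit:
  fixes a b :: "nat \<Rightarrow> 'a::idom fps"
  assumes a: "\<And>k. a (Suc k) = fps_X * a k * b (Suc k)"
    and b: "\<And>k. b (Suc k) = b k + a (Suc k)"
    and lim: "\<And>k. fps_X ^ k dvd V - b k"
  defines "N \<equiv> fps_X\<^sup>2 * a 0 * b 0 + fps_X * a 0 - 1 - fps_X\<^sup>2 * (b 0)\<^sup>2"
  shows "N * V + (1 + fps_X\<^sup>2 * V\<^sup>2) * b 0 = 0"
proof (rule fps_eq_0_if_X_power_dvd)
  fix k
  have "N * b k = (fps_X\<^sup>2 * a k * b k + fps_X * a k - 1 - fps_X\<^sup>2 * (b k)\<^sup>2) * b 0"
    using recurrence_invariant[of a b k, OF a b] unfolding N_def .
  \<comment> \<open>After subtracting the identity at k, what remains lies in the ideal generated by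
    \<open>V - b k\<close> and \<open>a k\<close>, both divisible by x^k.\<close>
  then have "N * V + (1 + fps_X\<^sup>2 * V\<^sup>2) * b 0 =
      (V - b k) * (N + fps_X\<^sup>2 * (V + b k) * b 0) + a k * ((fps_X\<^sup>2 * b k + fps_X) * b 0)"
    by (simp add: algebra_simps power2_eq_square)
  also have "fps_X ^ k dvd \<dots>"
    by (intro dvd_add dvd_mult2 lim recurrence_X_power_dvd[of a b] a)
  finally show "fps_X ^ k dvd N * V + (1 + fps_X\<^sup>2 * V\<^sup>2) * b 0" .
qed

section \<open>The quadratic equation and the change of weight\<close>

text \<open>Multiplying the limit identity by \<open>t\<close>, where \<open>t * b 0 = s\<close> and
  \<open>t\<close> times the numerator at index 0 is \<open>- L\<close>, gives x^2 s V^2 - L V + s =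
  0. Completing the square produces the radicand.\<close>

lemma gf_quadratic:
  fixes v :: "step list \<Rightarrow> 'a::idom"
  assumes mult: "\<And>\<alpha> \<beta>. \<alpha> \<in> dyck_h_geq \<Longrightarrow> \<beta> \<in> dyck_h_geq \<Longrightarrow> \<alpha> \<noteq> [] \<Longrightarrow>
      v (Up # \<alpha> @ Down # \<beta>) = v \<alpha> * v \<beta>"
    and one: "\<And>\<beta>. \<beta> \<in> dyck_h_geq \<Longrightarrow> \<beta> \<noteq> [] \<Longrightarrow> v (Up # Down # \<beta>) = c * v \<beta>"
      "v [Up, Down] = d" "v [] = e"
  defines "t \<equiv> 1 - fps_const c * fps_X"
  defines "s \<equiv> fps_const e * t + fps_const d * fps_X"
  defines "L \<equiv> fps_X\<^sup>2 * fps_const e * s - fps_X\<^sup>2 * fps_const d + t"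
  shows "(L - 2 * fps_X\<^sup>2 * s * gf v dyck_h_geq)\<^sup>2 = L\<^sup>2 - 4 * fps_X\<^sup>2 * s\<^sup>2"
proof -
  define a where "a k = gf v (height_eq (Suc k))" for k
  define b where "b k = gf v (height_le (Suc k))" for k
  define V where "V = gf v dyck_h_geq"
  have ta: "t * a 0 = fps_const d * fps_X" and tb: "t * b 0 = s"
    using gf_height_1[of v, OF one] unfolding a_def b_def t_def s_def by simp_all
  have "(fps_X\<^sup>2 * a 0 * b 0 + fps_X * a 0 - 1 - fps_X\<^sup>2 * (b 0)\<^sup>2) * V + (1 + fps_X\<^sup>2 * V\<^sup>2) * b 0 = 0"
  proof (rule recurrence_limit)
    show "a (Suc k) = fps_X * a k * b (Suc k)" for k
      unfolding a_def b_def using mult by (rule gf_height_eq_Suc)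
    show "b (Suc k) = b k + a (Suc k)" for k
      unfolding a_def b_def by (rule gf_height_le_Suc)
    show "fps_X ^ k dvd V - b k" for k
      using X_power_dvd_gf_diff[of "Suc k" v] unfolding V_def b_def
      by (rule dvd_trans[rotated]) (simp add: le_imp_power_dvd)
  qed
  then have "0 = t\<^sup>2 * ((fps_X\<^sup>2 * a 0 * b 0 + fps_X * a 0 - 1 - fps_X\<^sup>2 * (b 0)\<^sup>2) * V +
      (1 + fps_X\<^sup>2 * V\<^sup>2) * b 0)" by simp
  also have "\<dots> = (fps_X\<^sup>2 * (t * a 0) * (t * b 0) + fps_X * (t * a 0) * t - t\<^sup>2 - fps_X\<^sup>2 * (t * b 0)\<^sup>2) * V +
      (1 + fps_X\<^sup>2 * V\<^sup>2) * (t * b 0) * t"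
    by (simp add: algebra_simps power2_eq_square)
  \<comment> \<open>Because \<open>s - fps_const d * fps_X\<close> is
    \<open>fps_const e * t\<close>, the terms x^3 d s - x^2 s^2 are together a multiple of
    \<open>t\<close>, so one factor \<open>t\<close> cancels.\<close>
  also have "\<dots> = t * ((1 + fps_X\<^sup>2 * V\<^sup>2) * s - L * V)"
    unfolding ta tb L_def s_def by (simp add: algebra_simps power2_eq_square)
  finally have quadratic: "(1 + fps_X\<^sup>2 * V\<^sup>2) * s - L * V = 0"
    using one_minus_X_mult_nonzero(2)[of "fps_const c"] unfolding t_def by simp
  have "(L - 2 * fps_X\<^sup>2 * s * V)\<^sup>2 =
      L\<^sup>2 - 4 * fps_X\<^sup>2 * s\<^sup>2 + 4 * fps_X\<^sup>2 * s * ((1 + fps_X\<^sup>2 * V\<^sup>2) * s - L * V)"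
    by (simp add: algebra_simps power2_eq_square)
  also have "\<dots> = L\<^sup>2 - 4 * fps_X\<^sup>2 * s\<^sup>2"
    by (simp only: quadratic) simp
  finally show ?thesis
    unfolding V_def .
qed

text \<open>Both series are multiplied by \<open>1 / (1 - x * a k)\<close> when the height bound is raised.\<close>

lemma gf_proportional:
  fixes v w :: "step list \<Rightarrow> 'a::idom"
  assumes v: "\<And>\<alpha> \<beta>. \<alpha> \<in> dyck_h_geq \<Longrightarrow> \<beta> \<in> dyck_h_geq \<Longrightarrow> \<alpha> \<noteq> [] \<Longrightarrow>
      v (Up # \<alpha> @ Down # \<beta>) = v \<alpha> * v \<beta>"
    and w: "\<And>\<alpha> \<beta>. \<alpha> \<in> dyck_h_geq \<Longrightarrow> \<beta> \<in> dyck_h_geq \<Longrightarrow> \<alpha> \<noteq> [] \<Longrightarrow>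
      w (Up # \<alpha> @ Down # \<beta>) = v \<alpha> * w \<beta>"
  shows "gf w dyck_h_geq * gf v (height_le 1) = gf v dyck_h_geq * gf w (height_le 1)"
proof -
  have step: "gf u (height_le (Suc k)) = gf u (height_le (Suc (Suc k))) * (1 - fps_X * gf v (height_eq (Suc k)))"
    if "\<And>\<alpha> \<beta>. \<alpha> \<in> dyck_h_geq \<Longrightarrow> \<beta> \<in> dyck_h_geq \<Longrightarrow> \<alpha> \<noteq> [] \<Longrightarrow>
      u (Up # \<alpha> @ Down # \<beta>) = v \<alpha> * u \<beta>" for u k
    using gf_height_eq_Suc[of u v, OF that] gf_height_le_Suc[of u "Suc k"]
    by (simp add: algebra_simps)
  have eq: "gf w (height_le (Suc k)) * gf v (height_le 1) = gf v (height_le (Suc k)) * gf w (height_le 1)" for k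
  proof (induction k)
    case (Suc k)
    have vk: "gf v (height_le (Suc k)) =
        gf v (height_le (Suc (Suc k))) * (1 - fps_X * gf v (height_eq (Suc k)))"
      by (rule step) (rule v)
    have wk: "gf w (height_le (Suc k)) =
        gf w (height_le (Suc (Suc k))) * (1 - fps_X * gf v (height_eq (Suc k)))"
      by (rule step) (rule w)
    let ?r = "1 - fps_X * gf v (height_eq (Suc k))"
    have "?r * (gf w (height_le (Suc (Suc k))) * gf v (height_le 1)) =
        gf w (height_le (Suc k)) * gf v (height_le 1)"
      by (simp only: wk mult_ac)
    also have "\<dots> = gf v (height_le (Suc k)) * gf w (height_le 1)"
      by (rule Suc)
    also have "\<dots> = ?r * (gf v (height_le (Suc (Suc k))) * gf w (height_le 1))"
      by (simp only: vk mult_ac)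
    finally show ?case
      using one_minus_X_mult_nonzero(1)[of "gf v (height_eq (Suc k))"] by (metis mult_left_cancel)
  qed simp
  \<comment> \<open>Modulo x^(k+1) the full series may be replaced by those of height at most k + 1,
    for which \<open>eq\<close> holds.\<close>
  have "gf w dyck_h_geq * gf v (height_le 1) - gf v dyck_h_geq * gf w (height_le 1) = 0"
  proof (rule fps_eq_0_if_X_power_dvd)
    fix k
    have "gf w dyck_h_geq * gf v (height_le 1) - gf v dyck_h_geq * gf w (height_le 1) =
      (gf w dyck_h_geq - gf w (height_le (Suc k))) * gf v (height_le 1) -
      (gf v dyck_h_geq - gf v (height_le (Suc k))) * gf w (height_le 1)"
      using eq[of k] by (simp add: left_diff_distrib)
    also have "fps_X ^ Suc k dvd \<dots>"
      by (intro dvd_diff dvd_mult2 X_power_dvd_gf_diff)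
    finally show "fps_X ^ k dvd gf w dyck_h_geq * gf v (height_le 1) - gf v dyck_h_geq * gf w (height_le 1)"
      by (rule dvd_trans[rotated]) (simp add: le_imp_power_dvd)
  qed
  then show ?thesis by simp
qed

section \<open>Counting occurrences of three-letter patterns\<close>

lemma occurrences_Nil [simp]: "p \<noteq> [] \<Longrightarrow> occurrences p [] = 0"
  by (simp add: occurrences_def)

lemma occurrences_Cons:
  assumes "p \<noteq> []"
  shows "occurrences p (s # P) = of_bool (take (length p) (s # P) = p) + occurrences p P"
proof -
  define I where "I P = {i. i + length p \<le> length P \<and> take (length p) (drop i P) = p}" for P
  have I: "I (s # P) = (if take (length p) (s # P) = p then {0} else {}) \<union> Suc ` I P"
  proof (rule set_eqI)
    fix i
    have "length p \<le> length (s # P)" if "take (length p) (s # P) = p"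
      using arg_cong[OF that, of length] by simp
    then show "i \<in> I (s # P) \<longleftrightarrow> i \<in> (if take (length p) (s # P) = p then {0} else {}) \<union> Suc ` I P"
      by (cases i) (auto simp: I_def)
  qed
  have "finite (I P)"
    by (rule finite_subset[of _ "{..length P}"]) (auto simp: I_def)
  then have "card (I (s # P)) = of_bool (take (length p) (s # P) = p) + card (I P)"
    unfolding I by (subst card_Un_disjoint) (auto simp: card_image)
  then show ?thesis
    by (simp add: occurrences_def I_def)
qed

text \<open>An occurrence across the join splits as 1 + 2 or 2 + 1 letters. Reversal turns the last
  letters of \<open>P\<close> into a prefix.\<close>

lemma occurrences_append:
  "occurrences [p, q, r] (P @ Q) = occurrences [p, q, r] P + occurrences [p, q, r] Q +
    of_bool (take 1 (rev P) = [p] \<and> take 2 Q = [q, r]) +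
    of_bool (take 2 (rev P) = [q, p] \<and> take 1 Q = [r])"
proof (induction P)
  case (Cons s P)
  \<comment> \<open>If \<open>P\<close> has two letters or more, an occurrence at the front of
    \<open>s # P\<close> stays clear of \<open>Q\<close>, and prepending \<open>s\<close> does not
    change the last two letters.\<close>
  consider "P = []" | u where "P = [u]" | u v P' where "P = u # v # P'"
    by (metis neq_Nil_conv)
  then show ?case
  proof cases
    case 1
    then show ?thesis by (cases Q) (auto simp: occurrences_Cons take_Cons')
  next
    case 2
    then show ?thesis using Cons by (cases Q) (auto simp: occurrences_Cons take_Cons')
  next
    case 3
    then have "2 \<le> length (rev P)" by simp
    then have "take (length [p, q, r]) ((s # P) @ Q) = take (length [p, q, r]) (s # P)"
      "take 1 (rev (s # P)) = take 1 (rev P)" "take 2 (rev (s # P)) = take 2 (rev P)"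
      by simp_all
    then show ?thesis
      using Cons by (simp only: append_Cons occurrences_Cons[OF list.distinct(2)])
  qed
qed simp

text \<open>Here \<open>fps_X\<close> is y, and the coefficient of y^k in the weight is the
  indicator of exactly k occurrences.\<close>

lemma pattern_gf_eq_gf: "pattern_gf p = gf (\<lambda>P. fps_X ^ occurrences p P) dyck_h_geq"
proof (intro fps_ext)
  fix n k
  have "{P. P \<in> dyck_h_geq \<and> length P = 2 * n \<and> occurrences p P = k} =
      {P. P \<in> dyck_h_geq \<and> length P = 2 * n} \<inter> {P. occurrences p P = k}" by blast
  then have "pattern_gf p $ n $ k = (\<Sum>P | P \<in> dyck_h_geq \<and> length P = 2 * n. of_bool (occurrences p P = k))"
    by (simp add: pattern_gf_def num_paths_def finite_length_eq)
  also have "\<dots> = gf (\<lambda>P. fps_X ^ occurrences p P) dyck_h_geq $ n $ k"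
    by (auto simp: gf_def fps_sum_nth intro!: sum.cong)
  finally show "pattern_gf p $ n $ k = gf (\<lambda>P. fps_X ^ occurrences p P) dyck_h_geq $ n $ k" .
qed

lemma dyck_h_geq_nonemptyE:
  assumes "P \<in> dyck_h_geq" "P \<noteq> []"
  obtains P' P'' where "P = Up # P'" "rev P = Down # P''" "P' \<noteq> []" "P'' \<noteq> []"
proof -
  obtain s P' where s: "P = s # P'"
    using assms(2) by (cases P) auto
  obtain t P'' where t: "rev P = t # P''"
    using assms(2) by (cases "rev P") auto
  have "P' \<noteq> []" "P'' \<noteq> []"
    using dyck_h_geq_even_length[OF assms(1)] s arg_cong[OF t, of length] by auto
  moreover have "s = Up"
    using dyck_h_geq_hd_last(1)[OF assms] s by simp
  moreover have "t = Down"
    using dyck_h_geq_hd_last(2)[OF assms] t by (metis hd_rev list.sel(1))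
  ultimately show ?thesis
    using that s t by blast
qed

text \<open>The end corrections for UDD and DDD look at the last two steps, which a nonempty \<beta>
  determines by itself.\<close>

lemma take_2_rev_first_return:
  assumes "\<beta> \<in> dyck_h_geq"
  shows "take 2 (rev (Up # \<alpha> @ Down # \<beta>)) =
    (if \<beta> \<noteq> [] then take 2 (rev \<beta>) else [Down, if \<alpha> = [] then Up else last \<alpha>])"
proof (cases "\<beta> = []")
  case True
  then show ?thesis
    by (cases \<alpha> rule: rev_cases) (auto simp: numeral_2_eq_2)
next
  case False
  then obtain \<beta>' where "rev \<beta> = Down # \<beta>'" "\<beta>' \<noteq> []"
    using assms by (elim dyck_h_geq_nonemptyE)
  then show ?thesis
    using False by (cases \<beta>') (auto simp: numeral_2_eq_2)
qed

text \<open>All four patterns have Down in the middle. None starts at the first Up, as \<alpha>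
  begins with Up, nor at the Down after \<alpha>, as \<beta> is empty or begins with Up. This leaves
  DDU formed with a nonempty \<beta>, and patterns completed by the Down after \<alpha>.\<close>

lemma occurrences_first_return:
  assumes "\<alpha> \<in> dyck_h_geq" "\<beta> \<in> dyck_h_geq" "\<alpha> \<noteq> []"
  shows "occurrences [p, Down, r] (Up # \<alpha> @ Down # \<beta>) =
    occurrences [p, Down, r] \<alpha> + occurrences [p, Down, r] \<beta> +
    of_bool (p = Down \<and> r = Up \<and> \<beta> \<noteq> []) + of_bool (take 2 (rev \<alpha>) = [Down, p] \<and> r = Down)"
proof -
  obtain \<alpha>' \<alpha>'' where \<alpha>: "\<alpha> = Up # \<alpha>'" "rev \<alpha> = Down # \<alpha>''"
    using assms(1,3) by (elim dyck_h_geq_nonemptyE)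
  have \<beta>: "take 1 \<beta> = (if \<beta> = [] then [] else [Up])"
    using dyck_h_geq_hd_last(1)[OF assms(2)] by (cases \<beta>) auto
  have "occurrences [p, Down, r] (Down # \<beta>) = occurrences [p, Down, r] \<beta>"
    using \<beta> by (cases \<beta>) (auto simp: occurrences_Cons)
  moreover have "occurrences [p, Down, r] (Up # \<alpha> @ Down # \<beta>) =
      occurrences [p, Down, r] (\<alpha> @ Down # \<beta>)"
    using \<alpha>(1) by (simp add: occurrences_Cons)
  moreover have "take 1 (rev \<alpha>) = [p] \<and> take 2 (Down # \<beta>) = [Down, r] \<longleftrightarrow>
      p = Down \<and> r = Up \<and> \<beta> \<noteq> []"
    using \<alpha>(2) \<beta> by (auto simp: numeral_2_eq_2)
  moreover have "take 1 (Down # \<beta>) = [r] \<longleftrightarrow> r = Down"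
    by auto
  ultimately show ?thesis
    by (simp only: occurrences_append)
qed

lemma occurrences_Up_Down:
  assumes "\<beta> \<in> dyck_h_geq"
  shows "occurrences [p, Down, r] (Up # Down # \<beta>) =
    occurrences [p, Down, r] \<beta> + of_bool (p = Up \<and> r = Up \<and> \<beta> \<noteq> [])"
  using dyck_h_geq_hd_last(1)[OF assms] by (cases \<beta>) (auto simp: occurrences_Cons)

section \<open>Square roots and the four patterns\<close>

text \<open>Since \<open>d\<close> is divisible by x, \<open>L - d * F\<close> inherits the constant
  term 1 of \<open>L\<close>, which selects the root.\<close>

lemma to_fract_eq_sqrt_quotient:
  assumes "(L - d * F)\<^sup>2 = A" "fps_nth (fps_nth L 0) 0 = 1" "fps_nth d 0 = 0" "d \<noteq> 0"
  shows "to_fract F = to_fract (L - gf_sqrt A) / to_fract d"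
proof -
  have "gf_sqrt A = L - d * F"
    using assms by (intro gf_sqrt_eqI) auto
  then show ?thesis
    using assms(4) by simp
qed

lemma udu_quadratic:
  defines "x \<equiv> fps_X :: real fps fps" and "y \<equiv> fps_const fps_X"
  shows "(1 + x * (x^2 - x^2*y - y) - 2 * x^2 * (x - x*y + 1) * pattern_gf [Up, Down, Up])\<^sup>2 =
    (1 + x * (x^2 - x^2*y - y))\<^sup>2 - 4 * x^2 * (x - x*y + 1)\<^sup>2"
proof -
  let ?v = "\<lambda>P. fps_X ^ occurrences [Up, Down, Up] P :: real fps"
  have occ: "occurrences [Up, Down, Up] [Up, Down] = 0"
    using occurrences_Up_Down[OF dyck_h_geq.Nil] by simp
  show ?thesis
    using gf_quadratic[of ?v fps_X 1 1]
    by (simp add: occurrences_first_return occurrences_Up_Down occ power_add pattern_gf_eq_gf x_def y_def)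
       (simp add: algebra_simps power2_eq_square)
qed

text \<open>A path ending in UD yields a UDD once a Down follows; the extra y in \<open>?v\<close>
  anticipates it. Here c = e = 1 and d = y.\<close>

lemma udd_quadratic:
  defines "x \<equiv> fps_X :: real fps fps" and "y \<equiv> fps_const fps_X"
  shows "(1 + x * (x^2*y - x^2 - x*y + x - 1) - 2 * x^2 * (x*y - x + 1)^2 * pattern_gf [Up, Down, Down])\<^sup>2 =
    (1 + x * (x^2*y - x^2 - x*y + x - 1))\<^sup>2 - 4 * x^2 * (x*y - x + 1)\<^sup>2"
proof -
  let ?w = "\<lambda>P. fps_X ^ occurrences [Up, Down, Down] P :: real fps"
  let ?v = "\<lambda>P. ?w P * (if take 2 (rev P) = [Down, Up] then fps_X else 1)"
  have occ: "occurrences [Up, Down, Down] [Up, Down] = 0"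
    using occurrences_Up_Down[OF dyck_h_geq.Nil] by simp
  have v: "?v (Up # \<alpha> @ Down # \<beta>) = ?v \<alpha> * ?v \<beta>"
    and w: "?w (Up # \<alpha> @ Down # \<beta>) = ?v \<alpha> * ?w \<beta>"
    if "\<alpha> \<in> dyck_h_geq" "\<beta> \<in> dyck_h_geq" "\<alpha> \<noteq> []" for \<alpha> \<beta>
    unfolding take_2_rev_first_return[OF that(2)] occurrences_first_return[OF that]
    using that dyck_h_geq_hd_last(2)[OF that(1,3)] by (auto simp: power_add)
  have v1: "?v (Up # Down # \<beta>) = 1 * ?v \<beta>" and w1: "?w (Up # Down # \<beta>) = 1 * ?w \<beta>"
    if "\<beta> \<in> dyck_h_geq" "\<beta> \<noteq> []" for \<beta>
    using take_2_rev_first_return[OF that(1), of "[]"] that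
    by (simp_all add: occurrences_Up_Down)
  have v0: "?v [Up, Down] = fps_X" "?v [] = 1" and w0: "?w [Up, Down] = 1" "?w [] = 1"
    by (simp_all add: occ)
  define W where "W = gf ?w dyck_h_geq"
  define V where "V = gf ?v dyck_h_geq"
  have s: "1 * (1 - 1 * x) + y * x = x*y - x + 1"
    by (simp add: algebra_simps)
  have "(1 - 1 * x) * gf ?v (height_le 1) = x*y - x + 1"
    using gf_height_1(2)[of ?v, OF v1 v0]
    unfolding x_def[symmetric] y_def[symmetric] fps_const_1_eq_1 s .
  moreover have "(1 - 1 * x) * gf ?w (height_le 1) = 1 * (1 - 1 * x) + 1 * x"
    using gf_height_1(2)[of ?w, OF w1 w0]
    unfolding x_def[symmetric] fps_const_1_eq_1 .
  \<comment> \<open>For height at most 1 the two series are in the ratio x*y - x + 1 to 1, and this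
    ratio carries over to the full series.\<close>
  moreover have "W * gf ?v (height_le 1) = V * gf ?w (height_le 1)"
    unfolding V_def W_def by (rule gf_proportional; rule v w; assumption)
  then have "W * ((1 - 1 * x) * gf ?v (height_le 1)) = V * ((1 - 1 * x) * gf ?w (height_le 1))"
    by (simp only: mult.left_commute[of W] mult.left_commute[of V])
  ultimately have V: "V = (x*y - x + 1) * W"
    by (simp add: mult.commute)
  have L: "x\<^sup>2 * 1 * (x*y - x + 1) - x\<^sup>2 * y + (1 - 1 * x) = 1 + x * (x^2*y - x^2 - x*y + x - 1)"
    by (simp add: algebra_simps power2_eq_square)
  have "(1 + x * (x^2*y - x^2 - x*y + x - 1) - 2 * x\<^sup>2 * (x*y - x + 1) * V)\<^sup>2 =
      (1 + x * (x^2*y - x^2 - x*y + x - 1))\<^sup>2 - 4 * x\<^sup>2 * (x*y - x + 1)\<^sup>2"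
    using gf_quadratic[of ?v, OF v v1 v0]
    unfolding V_def[symmetric] x_def[symmetric] y_def[symmetric] fps_const_1_eq_1 s L .
  also have "1 + x * (x^2*y - x^2 - x*y + x - 1) - 2 * x\<^sup>2 * (x*y - x + 1) * V =
      1 + x * (x^2*y - x^2 - x*y + x - 1) - 2 * x^2 * (x*y - x + 1)^2 * W"
    unfolding V by (simp add: algebra_simps power2_eq_square)
  finally show ?thesis
    unfolding pattern_gf_eq_gf W_def .
qed

text \<open>A y on every nonempty path pays for the DDU formed when a nonempty \<beta> follows. The
  values of c, d, e are those of UDD, hence the same quadratic for \<open>V\<close> and the same
  radicand; only the passage from \<open>V\<close> to \<open>W\<close> differs.\<close>

lemma ddu_quadratic:
  defines "x \<equiv> fps_X :: real fps fps" and "y \<equiv> fps_const fps_X"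
  shows "(1 + x * (2*x^2*y^2 - 3*x^2*y + x^2 + x*y - x - 1) -
      2 * x^2 * y * (x*y - x + 1) * pattern_gf [Down, Down, Up])\<^sup>2 =
    (1 + x * (x^2*y - x^2 - x*y + x - 1))\<^sup>2 - 4 * x^2 * (x*y - x + 1)\<^sup>2"
proof -
  let ?w = "\<lambda>P. fps_X ^ occurrences [Down, Down, Up] P :: real fps"
  let ?v = "\<lambda>P. ?w P * (if P \<noteq> [] then fps_X else 1)"
  have occ: "occurrences [Down, Down, Up] [Up, Down] = 0"
    using occurrences_Up_Down[OF dyck_h_geq.Nil] by simp
  have v: "?v (Up # \<alpha> @ Down # \<beta>) = ?v \<alpha> * ?v \<beta>"
    if "\<alpha> \<in> dyck_h_geq" "\<beta> \<in> dyck_h_geq" "\<alpha> \<noteq> []" for \<alpha> \<beta>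
    unfolding occurrences_first_return[OF that] using that by (auto simp: power_add)
  have v1: "?v (Up # Down # \<beta>) = 1 * ?v \<beta>" if "\<beta> \<in> dyck_h_geq" "\<beta> \<noteq> []" for \<beta>
    using that by (simp add: occurrences_Up_Down)
  have v0: "?v [Up, Down] = fps_X" "?v [] = 1"
    by (simp_all add: occ)
  have split: "gf u dyck_h_geq = fps_const (u []) + gf u (dyck_h_geq - {[]})" for u :: "_ \<Rightarrow> real fps"
    using gf_union[of "{[]}" "dyck_h_geq - {[]}" u]
    by (simp add: gf_Nil insert_absorb[OF dyck_h_geq.Nil])
  define W where "W = gf ?w dyck_h_geq"
  define V where "V = gf ?v dyck_h_geq"
  have "gf ?v (dyck_h_geq - {[]}) = y * gf ?w (dyck_h_geq - {[]})"
    unfolding y_def by (rule gf_scale) auto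
  then have V: "V = 1 + y * (W - 1)"
    unfolding V_def W_def split[of ?v] split[of ?w] by simp
  have s: "1 * (1 - 1 * x) + y * x = x*y - x + 1"
    by (simp add: algebra_simps)
  have L: "x\<^sup>2 * 1 * (x*y - x + 1) - x\<^sup>2 * y + (1 - 1 * x) = 1 + x * (x^2*y - x^2 - x*y + x - 1)"
    by (simp add: algebra_simps power2_eq_square)
  have "(1 + x * (x^2*y - x^2 - x*y + x - 1) - 2 * x\<^sup>2 * (x*y - x + 1) * V)\<^sup>2 =
      (1 + x * (x^2*y - x^2 - x*y + x - 1))\<^sup>2 - 4 * x\<^sup>2 * (x*y - x + 1)\<^sup>2"
    using gf_quadratic[of ?v, OF v v1 v0]
    unfolding V_def[symmetric] x_def[symmetric] y_def[symmetric] fps_const_1_eq_1 s L .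
  also have "1 + x * (x^2*y - x^2 - x*y + x - 1) - 2 * x\<^sup>2 * (x*y - x + 1) * V =
      1 + x * (2*x^2*y^2 - 3*x^2*y + x^2 + x*y - x - 1) - 2 * x^2 * y * (x*y - x + 1) * W"
    unfolding V by (simp add: algebra_simps power2_eq_square)
  finally show ?thesis
    unfolding pattern_gf_eq_gf W_def .
qed

text \<open>A path ending in DD yields a DDD once a Down follows. The empty path also carries y: if
  \<alpha> is nonempty and \<beta> empty, the whole path ends in DD, and the factor of \<beta> must
  supply that correction. So e = y and c = d = 1.\<close>

lemma ddd_quadratic:
  defines "x \<equiv> fps_X :: real fps fps" and "y \<equiv> fps_const fps_X"
  shows "(1 - x * (x^2*y^2 - x^2*y - x*y^2 + x + 1) - 2 * x^2 * (x*y - x - y)^2 * pattern_gf [Down, Down, Down])\<^sup>2 =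
    (1 - x * (x^2*y^2 - x^2*y - x*y^2 + x + 1))\<^sup>2 - 4 * x^2 * (x*y - x - y)\<^sup>2"
proof -
  let ?w = "\<lambda>P. fps_X ^ occurrences [Down, Down, Down] P :: real fps"
  let ?v = "\<lambda>P. ?w P * (if P = [] \<or> take 2 (rev P) = [Down, Down] then fps_X else 1)"
  have occ: "occurrences [Down, Down, Down] [Up, Down] = 0"
    using occurrences_Up_Down[OF dyck_h_geq.Nil] by simp
  have v: "?v (Up # \<alpha> @ Down # \<beta>) = ?v \<alpha> * ?v \<beta>"
    and w: "?w (Up # \<alpha> @ Down # \<beta>) = ?v \<alpha> * ?w \<beta>"
    if "\<alpha> \<in> dyck_h_geq" "\<beta> \<in> dyck_h_geq" "\<alpha> \<noteq> []" for \<alpha> \<beta>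
    unfolding take_2_rev_first_return[OF that(2)] occurrences_first_return[OF that]
    using that dyck_h_geq_hd_last(2)[OF that(1,3)] by (auto simp: power_add)
  have v1: "?v (Up # Down # \<beta>) = 1 * ?v \<beta>" and w1: "?w (Up # Down # \<beta>) = 1 * ?w \<beta>"
    if "\<beta> \<in> dyck_h_geq" "\<beta> \<noteq> []" for \<beta>
    using take_2_rev_first_return[OF that(1), of "[]"] that
    by (simp_all add: occurrences_Up_Down)
  have v0: "?v [Up, Down] = 1" "?v [] = fps_X" and w0: "?w [Up, Down] = 1" "?w [] = 1"
    by (simp_all add: occ)
  define W where "W = gf ?w dyck_h_geq"
  define V where "V = gf ?v dyck_h_geq"
  have s: "y * (1 - 1 * x) + 1 * x = x + y - x*y"
    by (simp add: algebra_simps)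
  have "(1 - 1 * x) * gf ?v (height_le 1) = x + y - x*y"
    using gf_height_1(2)[of ?v, OF v1 v0]
    unfolding x_def[symmetric] y_def[symmetric] fps_const_1_eq_1 s .
  moreover have "(1 - 1 * x) * gf ?w (height_le 1) = 1 * (1 - 1 * x) + 1 * x"
    using gf_height_1(2)[of ?w, OF w1 w0]
    unfolding x_def[symmetric] fps_const_1_eq_1 .
  moreover have "W * gf ?v (height_le 1) = V * gf ?w (height_le 1)"
    unfolding V_def W_def by (rule gf_proportional; rule v w; assumption)
  then have "W * ((1 - 1 * x) * gf ?v (height_le 1)) = V * ((1 - 1 * x) * gf ?w (height_le 1))"
    by (simp only: mult.left_commute[of W] mult.left_commute[of V])
  ultimately have V: "V = (x + y - x*y) * W"
    by (simp add: mult.commute)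
  have L: "x\<^sup>2 * y * (x + y - x*y) - x\<^sup>2 * 1 + (1 - 1 * x) = 1 - x * (x^2*y^2 - x^2*y - x*y^2 + x + 1)"
    by (simp add: algebra_simps power2_eq_square)
  have "(1 - x * (x^2*y^2 - x^2*y - x*y^2 + x + 1) - 2 * x\<^sup>2 * (x + y - x*y) * V)\<^sup>2 =
      (1 - x * (x^2*y^2 - x^2*y - x*y^2 + x + 1))\<^sup>2 - 4 * x\<^sup>2 * (x + y - x*y)\<^sup>2"
    using gf_quadratic[of ?v, OF v v1 v0]
    unfolding V_def[symmetric] x_def[symmetric] y_def[symmetric] fps_const_1_eq_1 s L .
  also have "1 - x * (x^2*y^2 - x^2*y - x*y^2 + x + 1) - 2 * x\<^sup>2 * (x + y - x*y) * V =
      1 - x * (x^2*y^2 - x^2*y - x*y^2 + x + 1) - 2 * x^2 * (x*y - x - y)^2 * W"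
    unfolding V by (simp add: algebra_simps power2_eq_square)
  \<comment> \<open>The sign of this factor is immaterial, as only its square occurs.\<close>
  also have "(x + y - x*y)\<^sup>2 = (x*y - x - y)\<^sup>2"
    by (simp add: algebra_simps power2_eq_square)
  finally show ?thesis
    unfolding pattern_gf_eq_gf W_def .
qed

theorem theorem12:
  fixes x y A B C D :: "real fps fps"
  assumes "x = fps_X" and "y = fps_const fps_X"
    and "A = (x + 1) * (x^2*y - x^2 + x*y - x - 1) *
             (x^3*y - x^3 - 2*x^2*y + 2*x^2 + x*y + 2*x - 1)"
    and "B = (x + 1) * (x^2*y - x^2 + 1) *
             (x^3*y - x^3 - 3*x^2*y + 3*x^2 - 3*x + 1)"
    and "C = (x + 1) * (x^2*y - x^2 + 1) *
             (x^3*y - x^3 - 3*x^2*y + 3*x^2 - 3*x + 1)"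
    and "D = (x*y + 1) * (x^2*y - x^2 - x*y + x - 1) *
             (x^3*y^2 - x^3*y - x^2*y^2 - 2*x^2*y + 3*x^2 + 2*x*y + x - 1)"
  shows "to_fract (pattern_gf [Up, Down, Up]) =
           to_fract (1 + x * (x^2 - x^2*y - y) - gf_sqrt A) /
           to_fract (2 * x^2 * (x - x*y + 1)) \<and>
    to_fract (pattern_gf [Up, Down, Down]) =
           to_fract (1 + x * (x^2*y - x^2 - x*y + x - 1) - gf_sqrt B) /
           to_fract (2 * x^2 * (x*y - x + 1)^2) \<and>
    to_fract (pattern_gf [Down, Down, Up]) =
           to_fract (1 + x * (2*x^2*y^2 - 3*x^2*y + x^2 + x*y - x - 1) - gf_sqrt C) /
           to_fract (2 * x^2 * y * (x*y - x + 1)) \<and>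
    to_fract (pattern_gf [Down, Down, Down]) =
           to_fract (1 - x * (x^2*y^2 - x^2*y - x*y^2 + x + 1) - gf_sqrt D) /
           to_fract (2 * x^2 * (x*y - x - y)^2)"
proof -
  have const: "fps_nth x 0 = 0" "fps_nth y 0 = fps_X"
    using assms(1,2) by simp_all
  have x: "x \<noteq> 0"
    unfolding assms(1) by simp
  \<comment> \<open>The terms free of x are y, 1, 1 and -y.\<close>
  have nonzero: "y \<noteq> 0" "x - x*y + 1 \<noteq> 0" "x*y - x + 1 \<noteq> 0" "x*y - x - y \<noteq> 0"
    by (rule fps_nonzeroI[of _ 0], simp add: const)+
  \<comment> \<open>The factored form comes from the difference of squares (L - 2 x s)(L + 2 x s):
    up to sign, the last factor of \<open>A\<close> is the first of these and the other two multiply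
    to the second. \<open>B\<close> and \<open>D\<close> split similarly.\<close>
  have A: "A = (1 + x * (x^2 - x^2*y - y))\<^sup>2 - 4 * x^2 * (x - x*y + 1)\<^sup>2"
    unfolding assms(3) by (simp add: algebra_simps power2_eq_square power3_eq_cube)
  have B: "B = (1 + x * (x^2*y - x^2 - x*y + x - 1))\<^sup>2 - 4 * x^2 * (x*y - x + 1)\<^sup>2"
    unfolding assms(4) by (simp add: algebra_simps power2_eq_square power3_eq_cube)
  have D: "D = (1 - x * (x^2*y^2 - x^2*y - x*y^2 + x + 1))\<^sup>2 - 4 * x^2 * (x*y - x - y)\<^sup>2"
    unfolding assms(6) by (simp add: algebra_simps power2_eq_square power3_eq_cube)
  have "C = B"
    by (simp only: assms(4,5))
  show ?thesis
    unfolding \<open>C = B\<close>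
  proof (intro conjI)
    show "to_fract (pattern_gf [Up, Down, Up]) =
        to_fract (1 + x * (x^2 - x^2*y - y) - gf_sqrt A) / to_fract (2 * x^2 * (x - x*y + 1))"
      using udu_quadratic[folded assms(1,2), folded A]
      by (rule to_fract_eq_sqrt_quotient) (use x nonzero in \<open>simp_all add: const fps_nth_power_0\<close>)
    show "to_fract (pattern_gf [Up, Down, Down]) =
        to_fract (1 + x * (x^2*y - x^2 - x*y + x - 1) - gf_sqrt B) / to_fract (2 * x^2 * (x*y - x + 1)^2)"
      using udd_quadratic[folded assms(1,2), folded B]
      by (rule to_fract_eq_sqrt_quotient) (use x nonzero in \<open>simp_all add: const fps_nth_power_0\<close>)
    show "to_fract (pattern_gf [Down, Down, Up]) =
        to_fract (1 + x * (2*x^2*y^2 - 3*x^2*y + x^2 + x*y - x - 1) - gf_sqrt B) /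
        to_fract (2 * x^2 * y * (x*y - x + 1))"
      using ddu_quadratic[folded assms(1,2), folded B]
      by (rule to_fract_eq_sqrt_quotient) (use x nonzero in \<open>simp_all add: const fps_nth_power_0\<close>)
    show "to_fract (pattern_gf [Down, Down, Down]) =
        to_fract (1 - x * (x^2*y^2 - x^2*y - x*y^2 + x + 1) - gf_sqrt D) / to_fract (2 * x^2 * (x*y - x - y)^2)"
      using ddd_quadratic[folded assms(1,2), folded D]
      by (rule to_fract_eq_sqrt_quotient) (use x nonzero in \<open>simp_all add: const fps_nth_power_0\<close>)
  qed
qed

end
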